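(* For every $m\ge1$, let $s_m=[s[m,n,k]]_{n,k\ge0}$ and $S_m=[S[m,n,k]]_{n,k\ge0}$ (infinite lower-triangular matrices). Then $s_mS_m=I$.
   Context: $[j]=1+q+\dots+q^{j-1}$. $s[m,n,k]=(-1)^{n-k}e_{n-k}([1],[m+1],\dots,[(n-1)m+1])$, where $e_j$ is the elementary symmetric polynomial of degree $j$ ($e_j=0$ for $j<0$ or $j$ exceeding the number of variables; $e_0=1$). Let $\zeta_m=e^{2\pi i/m}$, $i^c=\zeta_m^c\mathbf e_i$ for $i\in[n]$ (colors mod $m$), $[n^m]=\{0\}\cup\{i^c:i\in[n],0\le c<m\}$, $zS=\{zs:s\in S\}$. A colored set partition of type $(m,n)$ is a set partition of $[n^m]$ into blocks $S_0,\dots,S_{km}$ with (i) $0\in S_0$ and if some $i^c\in S_0$ then all $i^d\in S_0$; (ii) for each $0\le l<k$, $S_{lm+1},\dots,S_{(l+1)m}$ are distinct and of the form $S,\zeta_mS,\dots,\zeta_m^{m-1}S$. With $\operatorname{minb}S=0$ if $0\in S$ and otherwise the least base in $S$, the standard form labels blocks so that (ii) holds, $s_i=\operatorname{minb}S_i$ satisfy $0=s_0<s_m<\dots<s_{km}$, and $s_j^{\,r}\in S_j$ for $j\in[km]$ with $r=j\bmod m$. An inversion is a pair $(i^0,S_l)$ with $i^0\in S_j$, $j<l$, $i\ge s_l$. $S[m,n,k]=\sum q^{\operatorname{inv}\sigma}$ over type $(m,n)$ colored set partitions of $[n^m]$ with $km+1$ blocks (so $S[m,n,k]=0$ for $k>n$).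 *)

theory Defs
  imports
    Complex_Main
    "HOL-Computational_Algebra.Polynomial"
    "HOL-Library.Disjoint_Sets"
    "HOL-Library.Groups_Big_Fun"
begin

text \<open>The parameter \<open>q\<close> is an indeterminate: all matrix entries are in \<open>\<int>[q]\<close>.\<close>

definition qvar :: "int poly" where
  "qvar = [:0, 1:]"

definition qint :: "nat \<Rightarrow> int poly" where
  "qint j = (\<Sum>i<j. qvar ^ i)"

text \<open>The integer degree \<open>j\<close> makes \<open>e\<^sub>j = 0\<close> for negative \<open>j\<close>, since the sum is then empty.\<close>

definition elem_sym :: "'i set \<Rightarrow> ('i \<Rightarrow> 'a::comm_ring_1) \<Rightarrow> int \<Rightarrow> 'a" where
  "elem_sym I x j = (\<Sum>T | T \<subseteq> I \<and> int (card T) = j. \<Prod>i\<in>T. x i)"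

text \<open>For \<open>k > n\<close> the truncated exponent \<open>n - k\<close> is harmless, as the second factor vanishes.\<close>

definition stirling_s :: "nat \<Rightarrow> nat \<Rightarrow> nat \<Rightarrow> int poly" where
  "stirling_s m n k =
     (- 1) ^ (n - k) * elem_sym {..<n} (\<lambda>i. qint (i * m + 1)) (int n - int k)"

text \<open>
  Vectors are functions \<open>nat \<Rightarrow> complex\<close>; only coordinates in \<open>{1..n}\<close> of elements of
  \<open>colored_set m n\<close> can be nonzero. In \<open>colored m i c\<close> the color \<open>c\<close> is automatically read
  modulo \<open>m\<close>.
\<close>

type_synonym cvec = "nat \<Rightarrow> complex"

definition zeta :: "nat \<Rightarrow> complex" where
  "zeta m = exp (2 * of_real pi * \<i> / of_nat m)"

definition zero_vec :: cvec where
  "zero_vec = (\<lambda>_. 0)"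

definition unit_vec :: "nat \<Rightarrow> cvec" where
  "unit_vec i = (\<lambda>j. if j = i then 1 else 0)"

definition scale_vec :: "complex \<Rightarrow> cvec \<Rightarrow> cvec" where
  "scale_vec z v = (\<lambda>j. z * v j)"

definition colored :: "nat \<Rightarrow> nat \<Rightarrow> nat \<Rightarrow> cvec" where
  "colored m i c = scale_vec (zeta m ^ c) (unit_vec i)"

definition colored_set :: "nat \<Rightarrow> nat \<Rightarrow> cvec set" where
  "colored_set m n = insert zero_vec {colored m i c | i c. i \<in> {1..n} \<and> c < m}"

text \<open>
  A labelling \<open>S\<^sub>0, \<dots>, S\<^sub>k\<^sub>m\<close> of the blocks is the list \<open>B\<close> with \<open>B ! j = S\<^sub>j\<close>;
  \<open>distinct B\<close> makes the blocks, in particular those within one group, distinct.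
\<close>

definition colored_labelling :: "nat \<Rightarrow> nat \<Rightarrow> nat \<Rightarrow> cvec set list \<Rightarrow> bool" where
  "colored_labelling m n k B \<longleftrightarrow>
     length B = k * m + 1 \<and> distinct B \<and> partition_on (colored_set m n) (set B) \<and>
     zero_vec \<in> B ! 0 \<and>
     (\<forall>i\<in>{1..n}. (\<exists>c<m. colored m i c \<in> B ! 0) \<longrightarrow> (\<forall>d<m. colored m i d \<in> B ! 0)) \<and>
     (\<forall>l<k. \<exists>S. \<forall>r<m. B ! (l * m + r + 1) = scale_vec (zeta m ^ r) ` S)"

definition colored_partitions :: "nat \<Rightarrow> nat \<Rightarrow> cvec set set set" where
  "colored_partitions m n = {P. \<exists>k B. colored_labelling m n k B \<and> P = set B}"

definition minb :: "nat \<Rightarrow> cvec set \<Rightarrow> nat" where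
  "minb m S = (if zero_vec \<in> S then 0 else LEAST i. \<exists>c<m. colored m i c \<in> S)"

definition standard_labelling :: "nat \<Rightarrow> nat \<Rightarrow> nat \<Rightarrow> cvec set list \<Rightarrow> bool" where
  "standard_labelling m n k B \<longleftrightarrow>
     colored_labelling m n k B \<and>
     minb m (B ! 0) = 0 \<and>
     (\<forall>l<k. minb m (B ! (l * m)) < minb m (B ! ((l + 1) * m))) \<and>
     (\<forall>j\<in>{1..k * m}. colored m (minb m (B ! j)) (j mod m) \<in> B ! j)"

text \<open>For \<open>m \<ge> 1\<close> each colored partition has exactly one standard labelling.\<close>

definition standard_form :: "nat \<Rightarrow> nat \<Rightarrow> cvec set set \<Rightarrow> cvec set list" where
  "standard_form m n P = (THE B. set B = P \<and> (\<exists>k. standard_labelling m n k B))"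

definition inversions :: "nat \<Rightarrow> nat \<Rightarrow> cvec set set \<Rightarrow> (cvec \<times> cvec set) set" where
  "inversions m n P =
     (let B = standard_form m n P in
      {(colored m i 0, B ! l) | i j l.
         i \<in> {1..n} \<and> l < length B \<and> j < l \<and> colored m i 0 \<in> B ! j \<and> i \<ge> minb m (B ! l)})"

definition stirling_S :: "nat \<Rightarrow> nat \<Rightarrow> nat \<Rightarrow> int poly" where
  "stirling_S m n k =
     (\<Sum>P | P \<in> colored_partitions m n \<and> card P = k * m + 1. qvar ^ card (inversions m n P))"

text \<open>
  Infinite matrices indexed by the naturals. \<open>Sum_any\<close> sums over all indices; for
  lower triangular factors only finitely many terms are nonzero.
\<close>

type_synonym 'a inf_matrix = "nat \<Rightarrow> nat \<Rightarrow> 'a"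

definition lower_triangular :: "'a::zero inf_matrix \<Rightarrow> bool" where
  "lower_triangular A \<longleftrightarrow> (\<forall>n k. n < k \<longrightarrow> A n k = 0)"

definition inf_matrix_mult :: "'a::comm_ring_1 inf_matrix \<Rightarrow> 'a inf_matrix \<Rightarrow> 'a inf_matrix" where
  "inf_matrix_mult A B = (\<lambda>n k. Sum_any (\<lambda>j. A n j * B j k))"

definition inf_matrix_one :: "'a::comm_ring_1 inf_matrix" where
  "inf_matrix_one = (\<lambda>n k. if n = k then 1 else 0)"

end

theory Submission imports Defs "HOL-Library.Infinite_Set" "HOL-Number_Theory.Cong" begin

text \<open>
  Record a standard form by the labels \<open>f i\<close> of the blocks containing \<open>i\<^sup>0\<close>. The functions that
  arise are restricted growth functions, and \<open>i\<^sup>0\<close> takes part in \<open>max (f 1, \<dots>, f i) - f i\<close>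
  inversions. When \<open>n + 1\<close> is added, it either opens a new group, without creating inversions,
  or joins the block with label \<open>j \<le> k m\<close>, creating \<open>k m - j\<close> inversions. Hence
  \<open>S[m,n+1,k] = S[m,n,k-1] + [k m + 1] S[m,n,k]\<close>, whereas
  \<open>s[m,n+1,k] = s[m,n,k-1] - [n m + 1] s[m,n,k]\<close>, so the product matrix satisfies the recurrence
  \<open>T(n+1,k) = T(n,k-1) + ([k m + 1] - [n m + 1]) T(n,k)\<close> of the identity matrix.
\<close>

section \<open>Colored vectors\<close>

text \<open>Multiplication by \<open>zeta m\<close> permutes the blocks of a group cyclically and
  fixes the zero block, so the vectors of color 0 carry all the information. The standard form
  removes the remaining freedom: for j = (l+1)m the required color j mod m is 0, so the least base
  of a group, taken with color 0, lies in the last block of its group. Opening a group therefore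
  assigns the largest label so far. This is why it costs no inversion, and why the running maximum
  of \<open>f\<close> tells which blocks have \<open>minb\<close> at most i. Since
  \<open>standard_form\<close> is a definite description, existence and uniqueness of the standard
  labelling both have to be proved before inversions can be counted.\<close>

lemma zeta_power: "zeta m ^ c = cis (2 * pi * real c / real m)"
proof -
  have "zeta m = cis (2 * pi / real m)"
    by (simp add: zeta_def cis_conv_exp algebra_simps)
  then show ?thesis
    by (simp add: Complex.DeMoivre mult.commute mult.left_commute)
qed

lemma zeta_power_mod:
  assumes "0 < m"
  shows "zeta m ^ (c mod m) = zeta m ^ c"
proof -
  have one: "zeta m ^ m = 1"
    using assms by (simp add: zeta_power)
  have "zeta m ^ c = zeta m ^ (m * (c div m) + c mod m)" by simp
  also have "\<dots> = zeta m ^ (c mod m)"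
    by (simp only: power_add power_mult one power_one mult_1)
  finally show ?thesis by simp
qed

lemma zeta_power_eq_iff:
  assumes "0 < m"
  shows "zeta m ^ c = zeta m ^ d \<longleftrightarrow> c mod m = d mod m"
proof
  assume "zeta m ^ c = zeta m ^ d"
  then have "zeta m ^ (c mod m) = zeta m ^ (d mod m)"
    by (simp add: zeta_power_mod assms)
  moreover have "inj_on (\<lambda>k. cis (2 * pi * real k / real m)) {..<m}"
    using bij_betw_roots_unity[OF assms] by (rule bij_betw_imp_inj_on)
  ultimately show "c mod m = d mod m"
    using assms by (auto simp: zeta_power inj_on_def)
next
  assume "c mod m = d mod m"
  then show "zeta m ^ c = zeta m ^ d"
    by (metis zeta_power_mod assms)
qed

lemma colored_eq_iff:
  assumes "0 < m"
  shows "colored m i c = colored m j d \<longleftrightarrow> i = j \<and> c mod m = d mod m"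
proof
  assume *: "colored m i c = colored m j d"
  have "zeta m ^ c \<noteq> 0" by (simp add: zeta_power)
  moreover from * have "colored m i c i = colored m j d i" by simp
  ultimately show "i = j \<and> c mod m = d mod m"
    using assms by (auto simp: colored_def scale_vec_def unit_vec_def zeta_power_eq_iff split: if_splits)
next
  assume "i = j \<and> c mod m = d mod m"
  then show "colored m i c = colored m j d"
    using zeta_power_eq_iff[OF assms, of c d] by (simp add: colored_def)
qed

lemma colored_neq_zero_vec [simp]:
  "colored m i c \<noteq> zero_vec" "zero_vec \<noteq> colored m i c"
proof -
  have "colored m i c i \<noteq> zero_vec i"
    by (simp add: colored_def scale_vec_def unit_vec_def zero_vec_def zeta_power)
  then show "colored m i c \<noteq> zero_vec" "zero_vec \<noteq> colored m i c" by auto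
qed

lemma scale_vec_colored: "scale_vec (zeta m ^ r) (colored m i c) = colored m i (r + c)"
  by (simp add: colored_def scale_vec_def power_add mult.assoc)

lemma scale_vec_scale_vec: "scale_vec a (scale_vec b v) = scale_vec (a * b) v"
  by (simp add: scale_vec_def mult.assoc)

lemma colored_in_colored_set:
  assumes "0 < m" "i \<in> {1..n}"
  shows "colored m i c \<in> colored_set m n"
proof -
  have "colored m i c = colored m i (c mod m)" "c mod m < m"
    using assms by (auto simp: colored_eq_iff)
  then show ?thesis
    using assms(2) unfolding colored_set_def by blast
qed

section \<open>Labellings as functions\<close>

text \<open>
  If \<open>p\<close> is the label of the block containing \<open>i\<^sup>0\<close>, then \<open>rot_label m p c\<close> is the label of the
  block containing \<open>i\<^sup>c\<close>. Hence a labelling is determined by the labels \<open>g i\<close> of the blocks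
  containing the vectors \<open>i\<^sup>0\<close>.
\<close>

definition rot_label :: "nat \<Rightarrow> nat \<Rightarrow> nat \<Rightarrow> nat" where
  "rot_label m p c = (if p = 0 then 0 else (p - 1) div m * m + (p - 1 + c) mod m + 1)"

text \<open>Colors run over all naturals here: for 0 < m, \<open>colored\<close> and
  \<open>rot_label\<close> depend only on the color modulo m, and colors can then be added without
  reduction.\<close>

definition block_of :: "nat \<Rightarrow> nat \<Rightarrow> (nat \<Rightarrow> nat) \<Rightarrow> nat \<Rightarrow> cvec set" where
  "block_of m n g j = {x. (x = zero_vec \<and> j = 0) \<or>
     (\<exists>i\<in>{1..n}. \<exists>c. x = colored m i c \<and> rot_label m (g i) c = j)}"

definition labelling_of :: "nat \<Rightarrow> nat \<Rightarrow> nat \<Rightarrow> (nat \<Rightarrow> nat) \<Rightarrow> cvec set list" where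
  "labelling_of m n k g = map (block_of m n g) [0..<k * m + 1]"

text \<open>Group l consists of the labels l*m+1, ..., (l+1)*m. One vector of color 0 in a group
  makes all its blocks nonempty, by rotation. The value 0 outside {1..n} makes equality of functions
  meaningful.\<close>

definition label_fun :: "nat \<Rightarrow> nat \<Rightarrow> nat \<Rightarrow> (nat \<Rightarrow> nat) \<Rightarrow> bool" where
  "label_fun m n k g \<longleftrightarrow> (\<forall>i. g i \<le> k * m) \<and> (\<forall>i. i \<notin> {1..n} \<longrightarrow> g i = 0) \<and>
     (\<forall>l<k. \<exists>i. l * m < g i \<and> g i \<le> Suc l * m)"

section \<open>Arithmetic of labels and their rotation\<close>

lemma label_cases:
  assumes "0 < (m::nat)"
  obtains "p = 0" | l r where "p = l * m + r + 1" "r < m"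
proof (cases p)
  case (Suc p')
  have "p = p' div m * m + p' mod m + 1" "p' mod m < m"
    using Suc assms by auto
  then show ?thesis using that by blast
qed (use that in blast)

text \<open>A multiple of m never cuts through a group, so comparing a label with it only involves
  the group index.\<close>

lemma label_bounds:
  assumes "r < (m::nat)"
  shows "l * m + r + 1 \<le> k * m \<longleftrightarrow> l < k"
    and "k * m < l * m + r + 1 \<longleftrightarrow> k \<le> l"
proof -
  have "l * m + r + 1 \<le> k * m" if "l < k"
  proof -
    have "Suc l * m \<le> k * m" using that by (intro mult_le_mono1) simp
    then show ?thesis using assms by simp
  qed
  moreover have "k * m < l * m + r + 1" if "k \<le> l"
    using mult_le_mono1[OF that, of m] by linarith
  ultimately show "l * m + r + 1 \<le> k * m \<longleftrightarrow> l < k" "k * m < l * m + r + 1 \<longleftrightarrow> k \<le> l"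
    by (metis not_le)+
qed

lemma label_eq_iff:
  assumes "r < (m::nat)" "r' < m"
  shows "l * m + r + 1 = l' * m + r' + 1 \<longleftrightarrow> l = l' \<and> r = r'"
proof
  assume eq: "l * m + r + 1 = l' * m + r' + 1"
  have "(l * m + r) div m = (l' * m + r') div m" "(l * m + r) mod m = (l' * m + r') mod m"
    using eq by simp_all
  then show "l = l' \<and> r = r'" using assms by simp
qed simp

context
  fixes m :: nat
  assumes m_pos: "0 < m"
begin

lemma rot_label_0 [simp]: "rot_label m 0 c = 0"
  by (simp add: rot_label_def)

lemma rot_label_label: "r < m \<Longrightarrow> rot_label m (l * m + r + 1) c = l * m + (r + c) mod m + 1"
  by (simp add: rot_label_def) (metis add.assoc mod_mult_self3)

lemma rot_label_eq_0_iff [simp]: "rot_label m p c = 0 \<longleftrightarrow> p = 0"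
  by (simp add: rot_label_def)

lemma rot_label_mod: "rot_label m p (c mod m) = rot_label m p c"
  unfolding rot_label_def by (simp only: mod_add_right_eq)

lemma rot_label_rot_label: "rot_label m (rot_label m p c) d = rot_label m p (c + d)"
proof (cases p rule: label_cases[OF m_pos])
  case (2 l r)
  show ?thesis
    unfolding 2(1) rot_label_label[OF 2(2)] rot_label_label[OF mod_less_divisor[OF m_pos]]
    by (simp add: mod_add_left_eq add.assoc)
qed simp

lemma rot_label_zero_right [simp]: "rot_label m p 0 = p"
proof (cases p rule: label_cases[OF m_pos])
  case (2 l r)
  then show ?thesis using rot_label_label[of r l 0] by simp
qed simp

lemma rot_label_le: "p \<le> k * m \<Longrightarrow> rot_label m p c \<le> k * m"
proof (cases p rule: label_cases[OF m_pos])
  case (2 l r)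
  assume "p \<le> k * m"
  then show ?thesis
    unfolding 2(1) rot_label_label[OF 2(2)] label_bounds(1)[OF mod_less_divisor[OF m_pos]]
    using 2 label_bounds(1) by blast
qed simp

lemma ex_rot_label:
  assumes "r < m" "r' < m"
  shows "\<exists>c<m. rot_label m (l * m + r + 1) c = l * m + r' + 1"
proof -
  \<comment> \<open>Modulo m, m - r stands for -r, so c represents r' - r.\<close>
  define c where "c = (r' + (m - r)) mod m"
  have "(r + c) mod m = r'"
    unfolding c_def using assms by (simp add: mod_add_right_eq)
  moreover have "c < m" using m_pos by (simp add: c_def)
  ultimately show ?thesis using rot_label_label[OF assms(1), of l c] by auto
qed

lemma colored_in_block_of [simp]:
  "i \<in> {1..n} \<Longrightarrow> colored m i c \<in> block_of m n g j \<longleftrightarrow> rot_label m (g i) c = j"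
  by (auto simp: block_of_def colored_eq_iff[OF m_pos]) (metis rot_label_mod)

lemma colored_in_block_ofD: "colored m i c \<in> block_of m n g j \<Longrightarrow> i \<in> {1..n}"
  by (auto simp: block_of_def colored_eq_iff[OF m_pos])

lemma zero_vec_in_block_of [simp]: "zero_vec \<in> block_of m n g j \<longleftrightarrow> j = 0"
  by (auto simp: block_of_def)

lemma colored_set_cases:
  assumes "x \<in> colored_set m n"
  obtains "x = zero_vec" | i c where "i \<in> {1..n}" "c < m" "x = colored m i c"
  using assms by (auto simp: colored_set_def)

lemma block_of_subset: "block_of m n g j \<subseteq> colored_set m n"
proof
  fix x assume "x \<in> block_of m n g j"
  then consider "x = zero_vec" | i c where "i \<in> {1..n}" "x = colored m i c"
    unfolding block_of_def by blast
  then show "x \<in> colored_set m n"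
    by cases (simp add: colored_set_def, simp add: colored_in_colored_set m_pos)
qed

lemma block_of_disjoint: "x \<in> block_of m n g j \<Longrightarrow> x \<in> block_of m n g j' \<Longrightarrow> j = j'"
proof -
  assume x: "x \<in> block_of m n g j" "x \<in> block_of m n g j'"
  then have "x \<in> colored_set m n" using block_of_subset by blast
  then show "j = j'" using x by (cases rule: colored_set_cases) auto
qed

lemma length_labelling_of [simp]: "length (labelling_of m n k g) = k * m + 1"
  by (simp add: labelling_of_def)

lemma nth_labelling_of [simp]: "j \<le> k * m \<Longrightarrow> labelling_of m n k g ! j = block_of m n g j"
  unfolding labelling_of_def by (subst nth_map) (auto simp del: upt_Suc)

lemma set_labelling_of: "set (labelling_of m n k g) = block_of m n g ` {..k * m}"
  by (auto simp: labelling_of_def simp del: upt_Suc)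

section \<open>Correspondence of label functions and colored labellings\<close>

lemma block_of_nonempty:
  assumes "label_fun m n k g" "j \<le> k * m"
  shows "block_of m n g j \<noteq> {}"
proof (cases j rule: label_cases[OF m_pos])
  case 1
  then show ?thesis using zero_vec_in_block_of[of n g j] by blast
next
  case (2 l r)
  with assms(2) have "l < k" using label_bounds(1) by blast
  then obtain i where i: "l * m < g i" "g i \<le> Suc l * m"
    using assms(1) unfolding label_fun_def by blast
  with assms(1) have "i \<in> {1..n}" unfolding label_fun_def by (metis not_less_zero)
  have "g i = l * m + (g i - l * m - 1) + 1" "g i - l * m - 1 < m"
    using i by auto
  then obtain c where "rot_label m (g i) c = j"
    using ex_rot_label[OF _ 2(2)] 2(1) by metis
  then show ?thesis using \<open>i \<in> {1..n}\<close> colored_in_block_of by blast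
qed

lemma colored_labelling_labelling_of:
  assumes "label_fun m n k g"
  shows "colored_labelling m n k (labelling_of m n k g)"
proof -
  have inj: "inj_on (block_of m n g) {..k * m}"
  proof (rule inj_onI)
    fix j j' assume "j \<in> {..k * m}" and eq: "block_of m n g j = block_of m n g j'"
    then obtain x where "x \<in> block_of m n g j" using block_of_nonempty[OF assms, of j] by auto
    then show "j = j'" using eq block_of_disjoint by metis
  qed
  have "distinct (labelling_of m n k g)"
    unfolding labelling_of_def distinct_map using inj
    by (auto simp del: upt_Suc simp: inj_on_def)
  moreover have "partition_on (colored_set m n) (set (labelling_of m n k g))"
  proof (rule partition_onI)
    show "\<Union> (set (labelling_of m n k g)) = colored_set m n"
    proof
      show "\<Union> (set (labelling_of m n k g)) \<subseteq> colored_set m n"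
        using block_of_subset by (auto simp: set_labelling_of)
      show "colored_set m n \<subseteq> \<Union> (set (labelling_of m n k g))"
      proof
        fix x assume "x \<in> colored_set m n"
        then show "x \<in> \<Union> (set (labelling_of m n k g))"
        proof (cases rule: colored_set_cases)
          case 1
          then show ?thesis by (auto simp: set_labelling_of intro!: bexI[of _ 0])
        next
          case (2 i c)
          have "rot_label m (g i) c \<le> k * m"
            using assms by (intro rot_label_le) (simp add: label_fun_def)
          then show ?thesis using 2 by (auto simp: set_labelling_of)
        qed
      qed
    qed
    show "{} \<notin> set (labelling_of m n k g)"
      using block_of_nonempty[OF assms] by (auto simp: set_labelling_of)
    show "disjnt p p'" if "p \<in> set (labelling_of m n k g)" "p' \<in> set (labelling_of m n k g)" "p \<noteq> p'"
      for p p'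
    proof -
      from that(1,2) obtain j j' where j: "p = block_of m n g j" "p' = block_of m n g j'"
        by (auto simp: set_labelling_of)
      then have "j \<noteq> j'" using that(3) by blast
      then show ?thesis unfolding j disjnt_def using block_of_disjoint by blast
    qed
  qed
  moreover have "\<exists>S. \<forall>r<m. labelling_of m n k g ! (l * m + r + 1) = scale_vec (zeta m ^ r) ` S"
    if "l < k" for l
  proof (intro exI allI impI)
    fix r assume r: "r < m"
    have le: "l * m + r + 1 \<le> k * m" using label_bounds(1)[OF r] that by blast
    \<comment> \<open>The witness S is the first block of the group; its label keeps the form
      \<open>l * m + 0 + 1\<close> so that the rotation rule applies.\<close>
    have "block_of m n g (l * m + r + 1) = scale_vec (zeta m ^ r) ` block_of m n g (l * m + 0 + 1)"
    proof (intro equalityI subsetI)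
      fix x assume "x \<in> block_of m n g (l * m + r + 1)"
      then obtain i c where i: "i \<in> {1..n}" "x = colored m i c" "rot_label m (g i) c = l * m + r + 1"
        unfolding block_of_def by auto
      \<comment> \<open>Rotating by m - r leads back to the first block, and the r-th power of
        \<open>zeta m\<close> then restores x.\<close>
      have "rot_label m (g i) (c + (m - r)) = rot_label m (l * m + r + 1) (m - r)"
        using i(3) rot_label_rot_label[of "g i" c "m - r"] by simp
      also have "\<dots> = l * m + 0 + 1" using rot_label_label[OF r] r by simp
      finally have "colored m i (c + (m - r)) \<in> block_of m n g (l * m + 0 + 1)"
        using i(1) by simp
      moreover have "x = scale_vec (zeta m ^ r) (colored m i (c + (m - r)))"
        using r i(2) by (simp add: scale_vec_colored colored_eq_iff m_pos)
      ultimately show "x \<in> scale_vec (zeta m ^ r) ` block_of m n g (l * m + 0 + 1)" by blast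
    next
      fix x assume "x \<in> scale_vec (zeta m ^ r) ` block_of m n g (l * m + 0 + 1)"
      then obtain i c where i: "i \<in> {1..n}" "x = scale_vec (zeta m ^ r) (colored m i c)"
        "rot_label m (g i) c = l * m + 0 + 1"
        unfolding block_of_def by auto
      have "rot_label m (g i) (c + r) = rot_label m (l * m + 0 + 1) r"
        using i(3) rot_label_rot_label[of "g i" c r] by simp
      also have "\<dots> = l * m + r + 1" using rot_label_label[OF m_pos, of l r] r by simp
      finally show "x \<in> block_of m n g (l * m + r + 1)"
        using i by (simp add: scale_vec_colored add.commute)
    qed
    then show "labelling_of m n k g ! (l * m + r + 1) =
        scale_vec (zeta m ^ r) ` block_of m n g (l * m + 0 + 1)"
      using nth_labelling_of[OF le] by simp
  qed
  \<comment> \<open>Condition (i) is left to the simplifier: rotation never moves the label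
    0.\<close>
  ultimately show ?thesis
    unfolding colored_labelling_def by simp
qed

text \<open>The label of i^0 determines those of all i^c. In block 0 this is condition (i).
  Elsewhere i^0 is the r-th power of \<open>zeta m\<close> times some v in the common set S of its
  group, so i^c is a multiple of the same v and lies at position (r + c) mod m of that group.
  Disjointness and distinctness of the blocks make labels unique.\<close>

lemma colored_labelling_imp_labelling_of:
  assumes "colored_labelling m n k B"
  obtains g where "label_fun m n k g" "B = labelling_of m n k g"
proof -
  have len: "length B = k * m + 1" and dist: "distinct B"
    and part: "partition_on (colored_set m n) (set B)"
    and zero: "zero_vec \<in> B ! 0"
    and closed: "\<And>i c d. i \<in> {1..n} \<Longrightarrow> c < m \<Longrightarrow> colored m i c \<in> B ! 0 \<Longrightarrow> d < m \<Longrightarrow>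
      colored m i d \<in> B ! 0"
    and groups: "\<And>l. l < k \<Longrightarrow> \<exists>S. \<forall>r<m. B ! (l * m + r + 1) = scale_vec (zeta m ^ r) ` S"
    using assms unfolding colored_labelling_def by blast+
  have ex: "\<exists>j\<le>k * m. x \<in> B ! j" if "x \<in> colored_set m n" for x
  proof -
    have "x \<in> \<Union> (set B)" using that part by (simp add: partition_on_def)
    then obtain j where "j < length B" "x \<in> B ! j" by (metis UnionE in_set_conv_nth)
    then show ?thesis using len by (intro exI[of _ j]) simp
  qed
  have uniq: "j = j'" if "x \<in> B ! j" "x \<in> B ! j'" "j \<le> k * m" "j' \<le> k * m" for x j j'
  proof -
    have "B ! j \<in> set B" "B ! j' \<in> set B" using that len by auto
    moreover have "B ! j \<inter> B ! j' \<noteq> {}" using that by blast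
    ultimately have "B ! j = B ! j'"
      using part unfolding partition_on_def disjoint_def by blast
    then show ?thesis using dist that len by (simp add: nth_eq_iff_index_eq)
  qed
  define g where "g i = (if i \<in> {1..n} then THE j. j \<le> k * m \<and> colored m i 0 \<in> B ! j else 0)" for i
  have g: "g i \<le> k * m" "colored m i 0 \<in> B ! g i" if i: "i \<in> {1..n}" for i
  proof -
    have "\<exists>!j. j \<le> k * m \<and> colored m i 0 \<in> B ! j"
      using ex[OF colored_in_colored_set[OF m_pos i]] uniq by blast
    from theI'[OF this] i show "g i \<le> k * m" "colored m i 0 \<in> B ! g i"
      by (simp_all add: g_def)
  qed
  have g0: "g i = 0" if "i \<notin> {1..n}" for i
    unfolding g_def using that by (rule if_not_P)
  have gc: "colored m i c \<in> B ! rot_label m (g i) c" if i: "i \<in> {1..n}" and "c < m" for i c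
  proof (cases "g i" rule: label_cases[OF m_pos])
    case 1
    then show ?thesis using closed[OF i m_pos _ \<open>c < m\<close>] g(2)[OF i] by simp
  next
    case (2 l r)
    then have "l < k" using g(1)[OF i] label_bounds(1) by metis
    from groups[OF this] obtain S where S: "\<And>r. r < m \<Longrightarrow> B ! (l * m + r + 1) = scale_vec (zeta m ^ r) ` S"
      by blast
    then obtain v where v: "v \<in> S" "colored m i 0 = scale_vec (zeta m ^ r) v"
      using g(2)[OF i] 2 by auto
    have "colored m i c = scale_vec (zeta m ^ c) (colored m i 0)"
      by (simp add: scale_vec_colored)
    also have "\<dots> = scale_vec (zeta m ^ ((r + c) mod m)) v"
      by (simp add: v(2) scale_vec_scale_vec zeta_power_mod[OF m_pos] flip: power_add)
        (simp add: add.commute)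
    finally show ?thesis
      unfolding 2(1) rot_label_label[OF 2(2)] using S[of "(r + c) mod m"] v(1) m_pos by simp
  qed
  have mem: "colored m i c \<in> B ! j \<longleftrightarrow> rot_label m (g i) c = j"
    if "i \<in> {1..n}" "c < m" "j \<le> k * m" for i c j
    using gc[OF that(1,2)] uniq[OF _ _ that(3) rot_label_le[OF g(1)[OF that(1)]]] by blast
  have sub: "B ! j \<subseteq> colored_set m n" if "j \<le> k * m" for j
    using part that len unfolding partition_on_def by (metis Sup_upper Suc_eq_plus1 less_Suc_eq_le nth_mem)
  have blk: "B ! j = block_of m n g j" if j: "j \<le> k * m" for j
  proof -
    have "x \<in> B ! j \<longleftrightarrow> x \<in> block_of m n g j" if "x \<in> colored_set m n" for x
      using that
    proof (cases rule: colored_set_cases)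
      case 1
      then show ?thesis using zero uniq[OF zero _ _ j] by auto
    next
      case (2 i c)
      then show ?thesis using mem[OF 2(1,2) j] by simp
    qed
    then show ?thesis using sub[OF j] block_of_subset by blast
  qed
  have "B = labelling_of m n k g"
    by (rule nth_equalityI) (use len blk in auto)
  moreover have "label_fun m n k g"
    unfolding label_fun_def
  proof (intro conjI allI impI)
    show "g i \<le> k * m" for i using g(1) g0 by (cases "i \<in> {1..n}") auto
    show "g i = 0" if "i \<notin> {1..n}" for i using g0 that by blast
    fix l assume l: "l < k"
    have le: "l * m + 0 + 1 \<le> k * m" using label_bounds(1)[OF m_pos] l by blast
    then have "B ! (l * m + 0 + 1) \<in> set B" using len by (metis less_Suc_eq_le nth_mem Suc_eq_plus1)
    then have "B ! (l * m + 0 + 1) \<noteq> {}" using part unfolding partition_on_def by metis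
    \<comment> \<open>The block yields a vector of arbitrary color c; rotation keeps the group, so
      the label of i^0 lies in group l as well.\<close>
    then obtain i c where "i \<in> {1..n}" and ic: "rot_label m (g i) c = l * m + 0 + 1"
      unfolding blk[OF le] block_of_def by auto
    show "\<exists>i. l * m < g i \<and> g i \<le> Suc l * m"
    proof (cases "g i" rule: label_cases[OF m_pos])
      case 1
      then show ?thesis using ic by simp
    next
      case (2 l' r)
      then have "l' = l"
        using ic rot_label_label[OF 2(2)] label_eq_iff[OF mod_less_divisor[OF m_pos] m_pos] by metis
      then show ?thesis using 2 by (intro exI[of _ i]) simp
    qed
  qed
  ultimately show ?thesis using that by blast
qed

section \<open>Restricted growth functions\<close>

lemma minb_block_of_0: "minb m (block_of m n g 0) = 0"
  by (simp add: minb_def)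

text \<open>The position r does not matter: a base with a label in group l occurs, in a suitable
  color, in every block of that group.\<close>

lemma minb_block_of:
  assumes "r < m" "\<And>i. i \<notin> {1..n} \<Longrightarrow> g i = 0"
  shows "minb m (block_of m n g (l * m + r + 1)) = (LEAST i. l * m < g i \<and> g i \<le> Suc l * m)"
proof -
  have "(\<exists>c<m. colored m i c \<in> block_of m n g (l * m + r + 1)) \<longleftrightarrow> l * m < g i \<and> g i \<le> Suc l * m"
    (is "?lhs \<longleftrightarrow> ?rhs") for i
  proof
    assume ?lhs
    then obtain c where c: "colored m i c \<in> block_of m n g (l * m + r + 1)" by blast
    with colored_in_block_ofD[OF c] have *: "rot_label m (g i) c = l * m + r + 1" by simp
    show ?rhs
    proof (cases "g i" rule: label_cases[OF m_pos])
      case 1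
      then show ?thesis using * by simp
    next
      case (2 l' r')
      then have "l' = l"
        using * rot_label_label[OF 2(2)] label_eq_iff[OF mod_less_divisor[OF m_pos] assms(1)] by metis
      then show ?thesis using 2 by simp
    qed
  next
    assume rhs: ?rhs
    then have "i \<in> {1..n}" using assms(2) by (metis not_less_zero)
    have "g i = l * m + (g i - l * m - 1) + 1" "g i - l * m - 1 < m"
      using rhs by auto
    then obtain c where "c < m" "rot_label m (g i) c = l * m + r + 1"
      using ex_rot_label[OF _ assms(1)] by metis
    then show ?lhs using \<open>i \<in> {1..n}\<close> by auto
  qed
  then show ?thesis by (simp add: minb_def)
qed

end

text \<open>
  The label functions of standard labellings: the least \<open>i\<close> with a label in the \<open>l\<close>-th group
  is labelled \<open>(l + 1) m\<close>, and it precedes every \<open>i\<close> with a label in a later group.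
\<close>

definition rgf :: "nat \<Rightarrow> nat \<Rightarrow> nat \<Rightarrow> (nat \<Rightarrow> nat) \<Rightarrow> bool" where
  "rgf m n k f \<longleftrightarrow> (\<forall>i. f i \<le> k * m) \<and> (\<forall>i. i \<notin> {1..n} \<longrightarrow> f i = 0) \<and>
     (\<forall>l<k. \<exists>a. f a = Suc l * m \<and> (\<forall>i. l * m < f i \<longrightarrow> a \<le> i))"

lemma rgf_le: "rgf m n k f \<Longrightarrow> f i \<le> k * m"
  by (simp add: rgf_def)

lemma rgf_outside: "rgf m n k f \<Longrightarrow> i \<notin> {1..n} \<Longrightarrow> f i = 0"
  unfolding rgf_def by blast

lemma rgf_opener:
  assumes "rgf m n k f" "l < k"
  obtains a where "f a = Suc l * m" "\<And>i. l * m < f i \<Longrightarrow> a \<le> i"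
  using assms unfolding rgf_def by blast

context
  fixes m :: nat
  assumes m_pos: "0 < m"
begin

section \<open>Restricted growth functions and standard labellings\<close>

lemma rgf_imp_label_fun:
  assumes "rgf m n k f"
  shows "label_fun m n k f"
  unfolding label_fun_def
proof (intro conjI allI impI)
  fix l assume "l < k"
  with assms obtain a where "f a = Suc l * m" by (rule rgf_opener)
  then show "\<exists>i. l * m < f i \<and> f i \<le> Suc l * m"
    using m_pos by (intro exI[of _ a]) simp
qed (use rgf_le[OF assms] rgf_outside[OF assms] in auto)

text \<open>The opener of a group is the least base of each of its blocks, and the growth condition
  extends its minimality to the bases of later groups.\<close>

lemma rgf_minb:
  assumes "rgf m n k f" "l < k" "r < m"
  defines "a \<equiv> minb m (block_of m n f (l * m + r + 1))"
  shows "f a = Suc l * m" and "l * m < f i \<Longrightarrow> a \<le> i"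
proof -
  obtain a' where a': "f a' = Suc l * m" "\<And>i. l * m < f i \<Longrightarrow> a' \<le> i"
    using rgf_opener[OF assms(1,2)] by blast
  have "a = (LEAST i. l * m < f i \<and> f i \<le> Suc l * m)"
    unfolding a_def by (rule minb_block_of[OF m_pos assms(3) rgf_outside[OF assms(1)]])
  also have "\<dots> = a'"
    by (rule Least_equality) (use a' m_pos in auto)
  finally show "f a = Suc l * m" "l * m < f i \<Longrightarrow> a \<le> i" using a' by auto
qed

text \<open>Normal form of an opener's label: it occupies the last position m - 1 of group l, where
  the standard form asks for color (l+1)m mod m = 0.\<close>

lemma Suc_mult_label: "Suc l * m = l * m + (m - 1) + 1"
  using m_pos by simp

text \<open>An opener has color 0 in the last block of its group, so its color r + 1 falls into
  position r, because (m - 1) + (r + 1) is congruent to r modulo m. This is the color required for j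
  = lm + r + 1.\<close>

lemma standard_labelling_labelling_of:
  assumes "rgf m n k f"
  shows "standard_labelling m n k (labelling_of m n k f)"
  unfolding standard_labelling_def
proof (intro conjI allI impI ballI)
  show "colored_labelling m n k (labelling_of m n k f)"
    by (intro colored_labelling_labelling_of rgf_imp_label_fun assms m_pos)
  show "minb m (labelling_of m n k f ! 0) = 0"
    by (simp add: nth_labelling_of m_pos minb_block_of_0)
next
  fix l assume l: "l < k"
  define b where "b l = minb m (block_of m n f (l * m))" for l
  have b: "f (b (Suc l)) = Suc l * m" "l * m < f i \<Longrightarrow> b (Suc l) \<le> i" if "l < k" for l i
    using rgf_minb[OF assms that, of "m - 1"] m_pos unfolding b_def Suc_mult_label by auto
  have "b l < b (Suc l)"
  proof (cases l)
    \<comment> \<open>Block 0 is not the last block of a group, so l = 0 is separate: its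
      \<open>minb\<close> is 0, and the base 0 has label 0 and opens nothing.\<close>
    case 0
    have "f 0 = 0" using rgf_outside[OF assms] by simp
    then have "b (Suc l) \<noteq> 0" using b(1)[OF l] m_pos by (metis mult_is_0 nat.distinct(1) not_gr_zero)
    then show ?thesis using 0 by (simp add: b_def minb_block_of_0 m_pos)
  next
    case (Suc l')
    then have l': "l' < k" using l by simp
    have "f (b (Suc l)) = m + f (b l)" using b(1)[OF l] b(1)[OF l'] Suc by simp
    moreover from this have "b l \<noteq> b (Suc l)" using m_pos by auto
    moreover have "l' * m < f (b (Suc l))" using b(1)[OF l] Suc m_pos by simp
    ultimately show ?thesis using b(2)[OF l'] Suc by fastforce
  qed
  moreover have "l * m \<le> k * m" "(l + 1) * m \<le> k * m" using l by (intro mult_le_mono1; simp)+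
  ultimately show "minb m (labelling_of m n k f ! (l * m)) < minb m (labelling_of m n k f ! ((l + 1) * m))"
    using nth_labelling_of[OF m_pos] by (simp add: b_def)
next
  fix j assume j: "j \<in> {1..k * m}"
  show "colored m (minb m (labelling_of m n k f ! j)) (j mod m) \<in> labelling_of m n k f ! j"
  proof (cases j rule: label_cases[OF m_pos])
    case 1
    then show ?thesis using j by simp
  next
    case (2 l r)
    have "l < k" using j 2 label_bounds(1)[OF 2(2)] by simp
    define a where "a = minb m (block_of m n f j)"
    have fa: "f a = Suc l * m"
      unfolding a_def 2(1) by (rule rgf_minb(1)[OF assms \<open>l < k\<close> 2(2)])
    then have "a \<in> {1..n}" using rgf_outside[OF assms, of a] m_pos by fastforce
    have "rot_label m (f a) (j mod m) = l * m + (m - 1 + j mod m) mod m + 1"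
      unfolding fa Suc_mult_label using m_pos by (intro rot_label_label) auto
    also have "(m - 1 + j mod m) mod m = (m - 1 + j) mod m" by (rule mod_add_right_eq)
    also have "m - 1 + j = r + (l + 1) * m" using 2 m_pos by simp
    also have "\<dots> mod m = r" using 2(2) by (simp only: mod_mult_self1 mod_less)
    finally have "colored m a (j mod m) \<in> block_of m n f j"
      using \<open>a \<in> {1..n}\<close> 2(1) by (simp add: colored_in_block_of m_pos)
    then show ?thesis using j by (simp add: nth_labelling_of m_pos a_def)
  qed
qed

text \<open>Here \<open>b (Suc l)\<close> is the least base of group l, and color 0 at j = (l+1)m
  gives it the label (l+1)m. A base in a later group is at least the least base of its own group,
  hence, as \<open>b\<close> increases, at least that of group l.\<close>

lemma standard_labelling_imp_rgf:
  assumes g: "label_fun m n k g" and std: "standard_labelling m n k (labelling_of m n k g)"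
  shows "rgf m n k g"
proof -
  define b where "b l = minb m (block_of m n g (l * m))" for l
  have le: "l * m \<le> k * m" if "l \<le> k" for l using that by (rule mult_le_mono1)
  have b_less: "b l < b (l + 1)" if "l < k" for l
  proof -
    have "minb m (labelling_of m n k g ! (l * m)) < minb m (labelling_of m n k g ! ((l + 1) * m))"
      using std that unfolding standard_labelling_def by blast
    then show ?thesis
      using le[of l] le[of "l + 1"] that by (simp only: b_def nth_labelling_of[OF m_pos])
  qed
  have mono: "b l \<le> b l'" if "l \<le> l'" "l' \<le> k" for l l'
    using that(1,2)
  proof (induction l' rule: dec_induct)
    case (step l')
    then show ?case using b_less[of l'] by simp
  qed simp
  have gb: "g (b (Suc l)) = Suc l * m" if "l < k" for l
  proof -
    have j: "Suc l * m \<in> {1..k * m}" using le[of "Suc l"] that m_pos by simp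
    then have "colored m (minb m (labelling_of m n k g ! (Suc l * m))) (Suc l * m mod m)
        \<in> labelling_of m n k g ! (Suc l * m)"
      using std unfolding standard_labelling_def by blast
    then have *: "colored m (b (Suc l)) 0 \<in> block_of m n g (Suc l * m)"
      using nth_labelling_of[OF m_pos, of "Suc l * m" k] j by (simp add: b_def)
    show ?thesis
      using * colored_in_block_of[OF m_pos colored_in_block_ofD[OF m_pos *]] rot_label_zero_right[OF m_pos]
      by simp
  qed
  have ble: "b (Suc l) \<le> i" if "l * m < g i" "l < k" for i l
  proof (cases "g i" rule: label_cases[OF m_pos])
    case 1
    then show ?thesis using that by simp
  next
    case (2 l' r)
    have "g i \<le> k * m" using g by (simp add: label_fun_def)
    then have "l' < k" using 2 label_bounds(1) by metis
    have "l \<le> l'" using that 2 label_bounds(2) by metis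
    have "b (Suc l') = (LEAST i. l' * m < g i \<and> g i \<le> Suc l' * m)"
      unfolding b_def Suc_mult_label[of l']
      by (subst minb_block_of) (use g m_pos in \<open>auto simp: label_fun_def add.commute\<close>)
    also have "\<dots> \<le> i" using 2 by (intro Least_le) simp
    finally show ?thesis using mono[of "Suc l" "Suc l'"] \<open>l \<le> l'\<close> \<open>l' < k\<close> by simp
  qed
  show ?thesis
    unfolding rgf_def
  proof (intro conjI)
    show "\<forall>l<k. \<exists>a. g a = Suc l * m \<and> (\<forall>i. l * m < g i \<longrightarrow> a \<le> i)"
      using gb ble by blast
  qed (use g in \<open>auto simp: label_fun_def\<close>)
qed

text \<open>The left-hand side mentions only the set of blocks. Hence two label functions with the
  same blocks have the same coincidences of rotated labels, which is all that the uniqueness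
  argument uses about nonzero labels.\<close>

lemma same_block_iff:
  assumes "label_fun m n k g" "i \<in> {1..n}" "i' \<in> {1..n}"
  shows "(\<exists>b\<in>set (labelling_of m n k g). colored m i c \<in> b \<and> colored m i' c' \<in> b) \<longleftrightarrow>
    rot_label m (g i) c = rot_label m (g i') c'"
proof -
  have "rot_label m (g i) c \<le> k * m"
    using assms(1) by (intro rot_label_le m_pos) (simp add: label_fun_def)
  then show ?thesis
    using assms(2,3) by (auto simp: set_labelling_of m_pos colored_in_block_of)
qed

lemma zero_block_iff:
  assumes "label_fun m n k g" "i \<in> {1..n}"
  shows "(\<exists>b\<in>set (labelling_of m n k g). colored m i 0 \<in> b \<and> zero_vec \<in> b) \<longleftrightarrow> g i = 0"
  using assms(2)
  by (auto simp: set_labelling_of m_pos colored_in_block_of zero_vec_in_block_of)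

text \<open>If i does not open its group, some a < i does, and i^0 shares a block with a^c for some
  c. That coincidence carries over to \<open>f'\<close>, which agrees with \<open>f\<close> at a, so
  the value at i is forced.\<close>

lemma rgf_unique_step:
  assumes "rgf m n k f"
    and same: "\<And>i i' c c'. i \<in> {1..n} \<Longrightarrow> i' \<in> {1..n} \<Longrightarrow> rot_label m (f i) c = rot_label m (f i') c' \<Longrightarrow>
      rot_label m (f' i) c = rot_label m (f' i') c'"
    and IH: "\<And>i'. i' < i \<Longrightarrow> f i' = f' i'" and i: "i \<in> {1..n}" and "f i \<noteq> 0"
  shows "f i = f' i \<or> (\<exists>l<k. f i = Suc l * m \<and> (\<forall>i'. l * m < f i' \<longrightarrow> i \<le> i'))"
proof (cases "f i" rule: label_cases[OF m_pos])
  case 1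
  then show ?thesis using \<open>f i \<noteq> 0\<close> by simp
next
  case (2 l r)
  then have "l < k" using rgf_le[OF assms(1), of i] label_bounds(1) by metis
  then obtain a where a: "f a = Suc l * m" "\<And>i. l * m < f i \<Longrightarrow> a \<le> i"
    using rgf_opener[OF assms(1)] by blast
  have "a \<le> i" using a(2)[of i] 2 by simp
  show ?thesis
  proof (cases "a = i")
    case True
    then show ?thesis using a \<open>l < k\<close> by blast
  next
    case False
    with \<open>a \<le> i\<close> have "a < i" by simp
    have "a \<in> {1..n}" using a(1) rgf_outside[OF assms(1), of a] m_pos by fastforce
    have "\<exists>c<m. rot_label m (f a) c = f i"
      unfolding a(1) 2(1) Suc_mult_label by (rule ex_rot_label) (use m_pos 2 in auto)
    then obtain c where c: "rot_label m (f a) c = rot_label m (f i) 0"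
      using rot_label_zero_right[OF m_pos] by auto
    have "rot_label m (f' a) c = rot_label m (f' i) 0"
      by (rule same[OF \<open>a \<in> {1..n}\<close> i c])
    then show ?thesis using IH[OF \<open>a < i\<close>] c rot_label_zero_right[OF m_pos] by simp
  qed
qed

text \<open>By \<open>rgf_unique_step\<close>, the values at i can differ only if i opens a group
  for both functions. The lower of the two groups was then opened before i by the other function,
  which is impossible since both agree below i.\<close>

lemma rgf_eqI:
  assumes f: "rgf m n k f" and f': "rgf m n k f'"
    and eq: "set (labelling_of m n k f) = set (labelling_of m n k f')"
  shows "f = f'"
proof
  note lf = rgf_imp_label_fun[OF f] and lf' = rgf_imp_label_fun[OF f']
  have same: "rot_label m (f i) c = rot_label m (f i') c' \<longleftrightarrow> rot_label m (f' i) c = rot_label m (f' i') c'"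
    if "i \<in> {1..n}" "i' \<in> {1..n}" for i i' c c'
    using same_block_iff[OF lf that] same_block_iff[OF lf' that] eq by simp
  have zero: "f i = 0 \<longleftrightarrow> f' i = 0" if "i \<in> {1..n}" for i
    using zero_block_iff[OF lf that] zero_block_iff[OF lf' that] eq by simp
  fix i
  show "f i = f' i"
  proof (induction i rule: less_induct)
    case (less i)
    have contra: False
      if "rgf m n k p'" "l < l'" "l < k" "p' i = Suc l' * m"
        "\<And>i'. l * m < p i' \<Longrightarrow> i \<le> i'" "\<And>i'. i' < i \<Longrightarrow> p i' = p' i'" for p p' l l'
    proof -
      note p' = that(1,3)
      obtain a where a: "p' a = Suc l * m" "\<And>i. l * m < p' i \<Longrightarrow> a \<le> i"
        using rgf_opener[OF p'] by blast
      have lt: "Suc l * m < Suc l' * m" using \<open>l < l'\<close> m_pos by simp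
      then have "l * m < p' i" unfolding that(4) by (simp only: mult_Suc)
      then have "a \<le> i" by (rule a(2))
      moreover have "a \<noteq> i" using a(1) that(4) lt by auto
      ultimately have "a < i" by simp
      moreover from this have "l * m < p a" using that(6) a(1) m_pos by simp
      ultimately show False using that(5)[of a] by simp
    qed
    show ?case
    proof (cases "i \<in> {1..n} \<and> f i \<noteq> 0")
      case False
      then show ?thesis using zero rgf_outside[OF f] rgf_outside[OF f'] by metis
    next
      case True
      then have i: "i \<in> {1..n}" "f i \<noteq> 0" "f' i \<noteq> 0" using zero[of i] by auto
      have 1: "f i = f' i \<or> (\<exists>l<k. f i = Suc l * m \<and> (\<forall>i'. l * m < f i' \<longrightarrow> i \<le> i'))"
        by (rule rgf_unique_step[OF f]) (use same less i in auto)
      have 2: "f' i = f i \<or> (\<exists>l<k. f' i = Suc l * m \<and> (\<forall>i'. l * m < f' i' \<longrightarrow> i \<le> i'))"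
        by (rule rgf_unique_step[OF f']) (use same less i in auto)
      show ?thesis
      proof (rule ccontr)
        assume ne: "f i \<noteq> f' i"
        with 1 obtain l where l: "l < k" "f i = Suc l * m" "\<And>i'. l * m < f i' \<Longrightarrow> i \<le> i'" by blast
        from ne 2 obtain l' where l': "l' < k" "f' i = Suc l' * m" "\<And>i'. l' * m < f' i' \<Longrightarrow> i \<le> i'"
          by metis
        from ne l(2) l'(2) have "l \<noteq> l'" by auto
        then consider "l < l'" | "l' < l" by linarith
        then show False
        proof cases
          case 1
          show False by (rule contra[OF f' 1 l(1) l'(2) l(3) less])
        next
          case 2
          show False by (rule contra[OF f 2 l'(1) l(2) l'(3) less[symmetric]])
        qed
      qed
    qed
  qed
qed

text \<open>
  Sorting the groups by their least bases and rotating each group turns an arbitrary labelling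
  into a standard one.
\<close>

lemma ex_rgf_same_blocks:
  assumes g: "label_fun m n k g"
  obtains f where "rgf m n k f" "set (labelling_of m n k f) = set (labelling_of m n k g)"
proof -
  define a where "a l = (LEAST i. l * m < g i \<and> g i \<le> Suc l * m)" for l
  have a: "l * m < g (a l) \<and> g (a l) \<le> Suc l * m" if "l < k" for l
    unfolding a_def by (rule LeastI_ex) (use g that in \<open>auto simp: label_fun_def\<close>)
  have a_least: "a l \<le> i" if "l * m < g i" "g i \<le> Suc l * m" for l i
    unfolding a_def using that by (intro Least_le) simp
  have inj_a: "inj_on a {..<k}"
  proof (rule linorder_inj_onI')
    fix l l' assume l: "l \<in> {..<k}" "l' \<in> {..<k}" "l < l'"
    then have "Suc l * m \<le> l' * m" by (intro mult_le_mono1) simp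
    then show "a l \<noteq> a l'" using a[of l] a[of l'] l by auto
  qed
  have "finite (a ` {..<k})" "card (a ` {..<k}) = k" using inj_a by (simp_all add: card_image)
  \<comment> \<open>\<open>h\<close> lists the least bases of the groups in increasing order, so
    \<open>\<rho> l\<close> is the rank of group l and becomes its new index.\<close>
  then obtain h where h: "bij_betw h {..<k} (a ` {..<k})" and h_mono: "strict_mono_on {..<k} h"
    using ex_bij_betw_strict_mono_card[of "a ` {..<k}"] by metis
  define \<rho> where "\<rho> l = the_inv_into {..<k} h (a l)" for l
  have h\<rho>: "h (\<rho> l) = a l" if "l < k" for l
    unfolding \<rho>_def using h that by (intro f_the_inv_into_f_bij_betw) auto
  have \<rho>_bij: "bij_betw \<rho> {..<k} {..<k}"
    unfolding \<rho>_def using bij_betw_trans[OF inj_on_imp_bij_betw[OF inj_a] bij_betw_the_inv_into[OF h]]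
    by (simp add: comp_def)
  then have \<rho>_lt: "\<rho> l < k" if "l < k" for l using that by (auto simp: bij_betw_def)
  have \<rho>_eq: "l = l'" if "\<rho> l = \<rho> l'" "l < k" "l' < k" for l l'
    using \<rho>_bij that by (auto simp: bij_betw_def inj_on_def)
  \<comment> \<open>A label in group l moves to group \<open>\<rho> l\<close>; the shift by (l+1)m -
    g (a l) carries the label of the least base to the last position, where an opener must
    be.\<close>
  define \<phi> where "\<phi> p = (if p = 0 then 0
    else \<rho> ((p - 1) div m) * m + ((p - 1) mod m + (Suc ((p - 1) div m) * m - g (a ((p - 1) div m)))) mod m + 1)" for p
  have \<phi>_0: "\<phi> 0 = 0" by (simp add: \<phi>_def)
  have \<phi>: "\<phi> (l * m + r + 1) = \<rho> l * m + (r + (Suc l * m - g (a l))) mod m + 1" if "r < m" for l r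
    using that by (simp add: \<phi>_def)
  have \<phi>_eq_0: "\<phi> p = 0 \<longleftrightarrow> p = 0" for p by (simp add: \<phi>_def)
  have \<phi>_le: "\<phi> p \<le> k * m" if "p \<le> k * m" for p
  proof (cases p rule: label_cases[OF m_pos])
    case 1
    then show ?thesis by (simp add: \<phi>_0)
  next
    case (2 l r)
    then have "l < k" using that label_bounds(1) by metis
    then show ?thesis
      unfolding 2(1) \<phi>[OF 2(2)] label_bounds(1)[OF mod_less_divisor[OF m_pos]] by (rule \<rho>_lt)
  qed
  have \<phi>_inj: "inj_on \<phi> {..k * m}"
  proof (rule inj_onI)
    fix p p' assume p: "p \<in> {..k * m}" "p' \<in> {..k * m}" and eq: "\<phi> p = \<phi> p'"
    show "p = p'"
    proof (cases "p = 0 \<or> p' = 0")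
      case True
      then show ?thesis using eq \<phi>_eq_0 by metis
    next
      case False
      obtain l r where lr: "p = l * m + r + 1" "r < m"
        using False by (metis label_cases[OF m_pos])
      obtain l' r' where lr': "p' = l' * m + r' + 1" "r' < m"
        using False by (metis label_cases[OF m_pos])
      have "l < k" "l' < k" using p lr lr' label_bounds(1) by (metis atMost_iff)+
      have *: "\<rho> l = \<rho> l'" "(r + (Suc l * m - g (a l))) mod m = (r' + (Suc l' * m - g (a l'))) mod m"
        using eq unfolding lr(1) lr'(1) \<phi>[OF lr(2)] \<phi>[OF lr'(2)]
          label_eq_iff[OF mod_less_divisor[OF m_pos] mod_less_divisor[OF m_pos]] by blast+
      then have "l = l'" using \<rho>_eq \<open>l < k\<close> \<open>l' < k\<close> by blast
      define t where "t = Suc l * m - g (a l)"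
      have "(r + t) mod m = (r' + t) mod m" using *(2) \<open>l = l'\<close> by (simp only: t_def)
      then have "r mod m = r' mod m" by (metis cong_def cong_add_rcancel_nat)
      then show ?thesis using lr lr' \<open>l = l'\<close> by simp
    qed
  qed
  have \<phi>_image: "\<phi> ` {..k * m} = {..k * m}"
    by (rule endo_inj_surj[OF _ _ \<phi>_inj]) (use \<phi>_le in auto)
  \<comment> \<open>Regrouping and shifting both commute with rotation, so \<open>\<phi>\<close>
    relabels whole blocks without changing them.\<close>
  have \<phi>_rot: "rot_label m (\<phi> p) c = \<phi> (rot_label m p c)" for p c
  proof (cases p rule: label_cases[OF m_pos])
    case 1
    then show ?thesis by (simp add: \<phi>_0 m_pos)
  next
    case (2 l r)
    show ?thesis
      unfolding 2(1) \<phi>[OF 2(2)] rot_label_label[OF m_pos 2(2)]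
        rot_label_label[OF m_pos mod_less_divisor[OF m_pos]] \<phi>[OF mod_less_divisor[OF m_pos]]
      by (simp only: mod_add_left_eq mod_add_right_eq add_ac)
  qed
  have g_le: "g i \<le> k * m" for i using g by (simp add: label_fun_def)
  have "block_of m n (\<phi> \<circ> g) (\<phi> j) = block_of m n g j" if "j \<le> k * m" for j
  proof -
    have "rot_label m (\<phi> (g i)) c = \<phi> j \<longleftrightarrow> rot_label m (g i) c = j" for i c
      using inj_on_eq_iff[OF \<phi>_inj, of "rot_label m (g i) c" j] that rot_label_le[OF m_pos g_le]
      by (simp add: \<phi>_rot)
    then show ?thesis by (simp add: block_of_def \<phi>_eq_0)
  qed
  then have "block_of m n g ` {..k * m} = block_of m n (\<phi> \<circ> g) ` (\<phi> ` {..k * m})"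
    unfolding image_image by (intro image_cong) auto
  then have "set (labelling_of m n k (\<phi> \<circ> g)) = set (labelling_of m n k g)"
    by (simp add: set_labelling_of m_pos \<phi>_image)
  moreover have "rgf m n k (\<phi> \<circ> g)"
    unfolding rgf_def
  proof (intro conjI allI impI)
    show "(\<phi> \<circ> g) i \<le> k * m" for i using \<phi>_le g_le by simp
    show "(\<phi> \<circ> g) i = 0" if "i \<notin> {1..n}" for i
      using g that unfolding label_fun_def by (simp add: \<phi>_0)
    fix l assume "l < k"
    then obtain l0 where l0: "l0 < k" "\<rho> l0 = l"
      using \<rho>_bij unfolding bij_betw_def by (metis imageE lessThan_iff)
    show "\<exists>b. (\<phi> \<circ> g) b = Suc l * m \<and> (\<forall>i. l * m < (\<phi> \<circ> g) i \<longrightarrow> b \<le> i)"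
    proof (intro exI conjI allI impI)
      define r where "r = g (a l0) - l0 * m - 1"
      have r: "g (a l0) = l0 * m + r + 1" "r < m" using a[OF l0(1)] by (auto simp: r_def)
      have "r + (Suc l0 * m - g (a l0)) = m - 1" using r by simp
      then have "\<phi> (g (a l0)) = l * m + (m - 1) mod m + 1"
        using \<phi>[OF r(2), of l0] l0(2) r(1) by simp
      then show "(\<phi> \<circ> g) (a l0) = Suc l * m" using m_pos by simp
    next
      fix i assume i: "l * m < (\<phi> \<circ> g) i"
      show "a l0 \<le> i"
      proof (cases "g i" rule: label_cases[OF m_pos])
        case 1
        then show ?thesis using i by (simp add: \<phi>_0)
      next
        case (2 l1 r)
        then have "l1 < k" using g_le label_bounds(1) by metis
        have "l * m < \<rho> l1 * m + (r + (Suc l1 * m - g (a l1))) mod m + 1"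
          using i 2(1) \<phi>[OF 2(2)] by simp
        then have "l \<le> \<rho> l1"
          using label_bounds(2)[OF mod_less_divisor[OF m_pos]] by blast
        then have "h l \<le> h (\<rho> l1)"
          using strict_mono_on_leD[OF h_mono] \<open>l < k\<close> \<rho>_lt[OF \<open>l1 < k\<close>] by simp
        then have "a l0 \<le> a l1" using h\<rho>[OF l0(1)] h\<rho>[OF \<open>l1 < k\<close>] l0(2) by simp
        also have "a l1 \<le> i" by (rule a_least) (use 2 in auto)
        finally show ?thesis .
      qed
    qed
  qed
  ultimately show ?thesis using that by blast
qed

section \<open>Colored partitions as restricted growth functions\<close>

lemma card_labelled_blocks:
  assumes "colored_labelling m n k B"
  shows "card (set B) = k * m + 1"
  using assms unfolding colored_labelling_def by (simp add: distinct_card)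

text \<open>Injectivity is the uniqueness of standard labellings; surjectivity comes from sorting
  and rotating an arbitrary labelling. The cardinality determines k because m is positive.\<close>

lemma bij_betw_rgf_partitions:
  "bij_betw (\<lambda>f. set (labelling_of m n k f)) {f. rgf m n k f}
     {P \<in> colored_partitions m n. card P = k * m + 1}"
proof (rule bij_betw_imageI)
  show "inj_on (\<lambda>f. set (labelling_of m n k f)) {f. rgf m n k f}"
    by (rule inj_onI) (use rgf_eqI in blast)
  show "(\<lambda>f. set (labelling_of m n k f)) ` {f. rgf m n k f} =
      {P \<in> colored_partitions m n. card P = k * m + 1}"
  proof (intro equalityI subsetI)
    fix P assume "P \<in> (\<lambda>f. set (labelling_of m n k f)) ` {f. rgf m n k f}"
    then obtain f where f: "rgf m n k f" "P = set (labelling_of m n k f)" by blast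
    have "colored_labelling m n k (labelling_of m n k f)"
      by (intro colored_labelling_labelling_of m_pos rgf_imp_label_fun f)
    then show "P \<in> {P \<in> colored_partitions m n. card P = k * m + 1}"
      using card_labelled_blocks f(2) unfolding colored_partitions_def by blast
  next
    fix P assume "P \<in> {P \<in> colored_partitions m n. card P = k * m + 1}"
    then obtain k' B where B: "colored_labelling m n k' B" "P = set B" and "card P = k * m + 1"
      unfolding colored_partitions_def by blast
    then have "k' = k" using card_labelled_blocks[OF B(1)] m_pos by simp
    with B obtain g where "label_fun m n k g" "P = set (labelling_of m n k g)"
      using colored_labelling_imp_labelling_of[OF m_pos] by metis
    then show "P \<in> (\<lambda>f. set (labelling_of m n k f)) ` {f. rgf m n k f}"
      using ex_rgf_same_blocks[of n k g] by (metis image_eqI mem_Collect_eq)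
  qed
qed

text \<open>A competing standard labelling has equally many blocks, hence the same k, and comes from
  a restricted growth function with the same blocks, hence from \<open>f\<close>.\<close>

lemma standard_form_labelling_of:
  assumes f: "rgf m n k f"
  shows "standard_form m n (set (labelling_of m n k f)) = labelling_of m n k f"
  unfolding standard_form_def
proof (rule the_equality)
  show "set (labelling_of m n k f) = set (labelling_of m n k f) \<and>
      (\<exists>k'. standard_labelling m n k' (labelling_of m n k f))"
    using standard_labelling_labelling_of[OF f] by blast
next
  fix B assume B: "set B = set (labelling_of m n k f) \<and> (\<exists>k. standard_labelling m n k B)"
  then obtain k' where k': "standard_labelling m n k' B" by blast
  then have lab: "colored_labelling m n k' B" by (simp add: standard_labelling_def)
  have "colored_labelling m n k (labelling_of m n k f)"
    by (intro colored_labelling_labelling_of m_pos rgf_imp_label_fun f)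
  then have "k' = k" using card_labelled_blocks[OF lab] card_labelled_blocks B m_pos by fastforce
  with lab obtain g where g: "label_fun m n k g" "B = labelling_of m n k g"
    using colored_labelling_imp_labelling_of[OF m_pos] by metis
  have "rgf m n k g"
    using standard_labelling_imp_rgf[OF g(1)] k' \<open>k' = k\<close> g(2) by simp
  then have "g = f" using rgf_eqI[OF _ f] B g(2) by blast
  then show "B = labelling_of m n k f" using g(2) by simp
qed

end

text \<open>For restricted growth functions this is the total number of inversions. The index 0 in
  \<open>{..i}\<close> is harmless, as such functions vanish there, and the subtraction never
  truncates because \<open>f i\<close> itself enters the maximum.\<close>

definition rgf_weight :: "nat \<Rightarrow> (nat \<Rightarrow> nat) \<Rightarrow> nat" where
  "rgf_weight n f = (\<Sum>i = 1..n. Max (f ` {..i}) - f i)"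

context
  fixes m :: nat
  assumes m_pos: "0 < m"
begin

text \<open>Groups open in increasing order, each with its largest label. So the running maximum at
  i is m times the number of groups opened up to i, and block j has a base up to i exactly if its
  group is open.\<close>

lemma minb_le_iff:
  assumes f: "rgf m n k f" and j: "1 \<le> j" "j \<le> k * m"
  shows "minb m (block_of m n f j) \<le> i \<longleftrightarrow> j \<le> Max (f ` {..i})"
proof (cases j rule: label_cases[OF m_pos])
  case 1
  then show ?thesis using j by simp
next
  case (2 l r)
  then have "l < k" using j(2) label_bounds(1) by metis
  define a where "a = minb m (block_of m n f j)"
  have a: "f a = Suc l * m" "\<And>i. l * m < f i \<Longrightarrow> a \<le> i"
    using rgf_minb[OF m_pos f \<open>l < k\<close> 2(2)] unfolding a_def 2(1) by auto
  have "a \<le> i \<longleftrightarrow> j \<le> Max (f ` {..i})"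
  proof
    assume "a \<le> i"
    then have "f a \<le> Max (f ` {..i})" by (intro Max_ge) auto
    then show "j \<le> Max (f ` {..i})" using a(1) 2 by simp
  next
    assume le: "j \<le> Max (f ` {..i})"
    have "Max (f ` {..i}) \<in> f ` {..i}" by (intro Max_in) auto
    then obtain i' where "i' \<le> i" "Max (f ` {..i}) = f i'" by (metis atMost_iff imageE)
    then show "a \<le> i" using a(2)[of i'] le 2 by simp
  qed
  then show ?thesis by (simp add: a_def)
qed

text \<open>In an inversion the block containing i^0 is forced to have label \<open>f i\<close>,
  which leaves an interval of labels for the second block. Inversions record blocks instead of
  labels, so counting labels relies on the distinctness of the blocks.\<close>

lemma card_inversions_labelling_of:
  assumes f: "rgf m n k f"
  shows "card (inversions m n (set (labelling_of m n k f))) = rgf_weight n f"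
proof -
  have distinct: "distinct (labelling_of m n k f)"
    using colored_labelling_labelling_of[OF m_pos rgf_imp_label_fun[OF m_pos f]]
    by (simp add: colored_labelling_def)
  have inj: "j = j'" if "block_of m n f j = block_of m n f j'" "j \<le> k * m" "j' \<le> k * m" for j j'
    using distinct that nth_eq_iff_index_eq[OF distinct, of j j']
    by (simp add: nth_labelling_of length_labelling_of m_pos)
  have Max_le: "Max (f ` {..i}) \<le> k * m" for i
    using rgf_le[OF f] by (subst Max_le_iff) auto
  have "inversions m n (set (labelling_of m n k f)) =
      (\<lambda>(i, j). (colored m i 0, block_of m n f j)) ` (SIGMA i:{1..n}. {f i<..Max (f ` {..i})})"
    (is "_ = ?h ` ?A")
  proof (intro equalityI subsetI)
    fix x assume "x \<in> inversions m n (set (labelling_of m n k f))"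
    then obtain i j l where x: "x = (colored m i 0, labelling_of m n k f ! l)" "i \<in> {1..n}"
      "l \<le> k * m" "j < l" "colored m i 0 \<in> labelling_of m n k f ! j"
      "minb m (labelling_of m n k f ! l) \<le> i"
      unfolding inversions_def Let_def standard_form_labelling_of[OF m_pos f]
      by (auto simp: length_labelling_of m_pos)
    then have "j = f i"
      by (simp add: nth_labelling_of colored_in_block_of rot_label_zero_right m_pos)
    moreover have "l \<le> Max (f ` {..i})"
      using x minb_le_iff[OF f, of l i] by (simp add: nth_labelling_of m_pos)
    ultimately show "x \<in> ?h ` ?A"
      using x by (intro image_eqI[of _ _ "(i, l)"]) (auto simp: nth_labelling_of m_pos)
  next
    fix x assume "x \<in> ?h ` ?A"
    then obtain i l where x: "x = (colored m i 0, block_of m n f l)" "i \<in> {1..n}"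
      "f i < l" "l \<le> Max (f ` {..i})" by auto
    then have "l \<le> k * m" using Max_le order.trans by blast
    then have "minb m (block_of m n f l) \<le> i"
      using x minb_le_iff[OF f, of l i] by simp
    moreover have "colored m i 0 \<in> block_of m n f (f i)"
      using x by (simp add: colored_in_block_of rot_label_zero_right m_pos)
    ultimately show "x \<in> inversions m n (set (labelling_of m n k f))"
      unfolding inversions_def Let_def standard_form_labelling_of[OF m_pos f] mem_Collect_eq
      using x \<open>l \<le> k * m\<close>
      by (intro exI[of _ i] exI[of _ "f i"] exI[of _ l])
        (simp add: nth_labelling_of length_labelling_of m_pos)
  qed
  moreover have "inj_on ?h ?A"
  proof (rule inj_onI, clarify)
    fix i j i' j' assume ij: "i \<in> {1..n}" "j \<in> {f i<..Max (f ` {..i})}"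
      and ij': "i' \<in> {1..n}" "j' \<in> {f i'<..Max (f ` {..i'})}"
      and eq: "colored m i 0 = colored m i' 0" "block_of m n f j = block_of m n f j'"
    have "j \<le> k * m" "j' \<le> k * m"
      using ij(2) ij'(2) Max_le order.trans by (metis greaterThanAtMost_iff)+
    then show "i = i' \<and> j = j'" using inj[OF eq(2)] eq(1) colored_eq_iff[OF m_pos] by blast
  qed
  ultimately show ?thesis
    by (simp add: card_image rgf_weight_def)
qed

lemma stirling_S_eq_sum_rgf:
  "stirling_S m n k = (\<Sum>f | rgf m n k f. qvar ^ rgf_weight n f)"
proof -
  have "stirling_S m n k =
      (\<Sum>f | rgf m n k f. qvar ^ card (inversions m n (set (labelling_of m n k f))))"
    unfolding stirling_S_def
    using sum.reindex_bij_betw[OF bij_betw_rgf_partitions[OF m_pos, of n k],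
        of "\<lambda>P. qvar ^ card (inversions m n P)"] by simp
  then show ?thesis using card_inversions_labelling_of by simp
qed

section \<open>Adding one point to a restricted growth function\<close>

lemma rgf_upd:
  assumes f: "rgf m n k f" and j: "j \<le> k * m"
  shows "rgf m (Suc n) k (f(Suc n := j))"
  unfolding rgf_def
proof (intro conjI allI impI)
  fix l assume "l < k"
  then obtain a where a: "f a = Suc l * m" "\<And>i. l * m < f i \<Longrightarrow> a \<le> i"
    using rgf_opener[OF f] by blast
  then have "a \<in> {1..n}" using rgf_outside[OF f, of a] m_pos by fastforce
  then show "\<exists>a. (f(Suc n := j)) a = Suc l * m \<and> (\<forall>i. l * m < (f(Suc n := j)) i \<longrightarrow> a \<le> i)"
    using a by (intro exI[of _ a]) auto
qed (use rgf_le[OF f] rgf_outside[OF f] j in auto)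

lemma rgf_upd_new:
  assumes f: "rgf m n k f"
  shows "rgf m (Suc n) (Suc k) (f(Suc n := Suc k * m))"
  unfolding rgf_def
proof (intro conjI allI impI)
  fix l assume "l < Suc k"
  then consider "l < k" | "l = k" by linarith
  then show "\<exists>a. (f(Suc n := Suc k * m)) a = Suc l * m \<and>
      (\<forall>i. l * m < (f(Suc n := Suc k * m)) i \<longrightarrow> a \<le> i)"
  proof cases
    case 1
    then obtain a where a: "f a = Suc l * m" "\<And>i. l * m < f i \<Longrightarrow> a \<le> i"
      using rgf_opener[OF f] by blast
    then have "a \<in> {1..n}" using rgf_outside[OF f, of a] m_pos by fastforce
    then show ?thesis using a by (intro exI[of _ a]) auto
  next
    case 2
    then have "\<not> l * m < f i" for i using rgf_le[OF f, of i] by simp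
    then show ?thesis using 2 by (intro exI[of _ "Suc n"]) auto
  qed
next
  show "(f(Suc n := Suc k * m)) i \<le> Suc k * m" for i
    using rgf_le[OF f, of i] by simp
qed (use rgf_outside[OF f] in auto)

text \<open>The alternative is whether n + 1 opens a group. If it opens group l, there is no group l
  + 1: its opener would be at least n + 1 too, hence equal to n + 1, but with a different
  label.\<close>

lemma rgf_Suc_cases:
  assumes f: "rgf m (Suc n) k f"
  obtains "rgf m n k (f(Suc n := 0))"
    | k' where "k = Suc k'" "rgf m n k' (f(Suc n := 0))" "f (Suc n) = Suc k' * m"
proof (cases "\<exists>l<k. f (Suc n) = Suc l * m \<and> (\<forall>i. l * m < f i \<longrightarrow> Suc n \<le> i)")
  case False
  have "rgf m n k (f(Suc n := 0))"
    unfolding rgf_def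
  proof (intro conjI allI impI)
    fix l assume "l < k"
    then obtain a where a: "f a = Suc l * m" "\<And>i. l * m < f i \<Longrightarrow> a \<le> i"
      using rgf_opener[OF f] by blast
    with False \<open>l < k\<close> have "a \<noteq> Suc n" by blast
    then show "\<exists>a. (f(Suc n := 0)) a = Suc l * m \<and> (\<forall>i. l * m < (f(Suc n := 0)) i \<longrightarrow> a \<le> i)"
      using a by (intro exI[of _ a]) auto
  qed (use rgf_le[OF f] rgf_outside[OF f] in auto)
  then show ?thesis using that by blast
next
  case True
  then obtain l where l: "l < k" "f (Suc n) = Suc l * m" "\<And>i. l * m < f i \<Longrightarrow> Suc n \<le> i"
    by blast
  have "k = Suc l"
  proof (rule ccontr)
    assume "k \<noteq> Suc l"
    then have "Suc l < k" using l by simp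
    then obtain a where a: "f a = Suc (Suc l) * m" using rgf_opener[OF f] by blast
    then have "a \<in> {1..Suc n}" using rgf_outside[OF f, of a] m_pos by fastforce
    moreover have "Suc n \<le> a" by (rule l(3)) (use a m_pos in simp)
    ultimately have "a = Suc n" by simp
    then show False using a l(2) m_pos by simp
  qed
  moreover have "rgf m n l (f(Suc n := 0))"
    unfolding rgf_def
  proof (intro conjI allI impI)
    show "(f(Suc n := 0)) i \<le> l * m" for i
    proof (cases "i < Suc n")
      case True
      then show ?thesis using l(3)[of i] by (auto simp: not_less[symmetric])
    next
      case False
      then show ?thesis using rgf_outside[OF f, of i] by auto
    qed
    fix l' assume "l' < l"
    then obtain a where a: "f a = Suc l' * m" "\<And>i. l' * m < f i \<Longrightarrow> a \<le> i"
      using rgf_opener[OF f, of l'] l(1) by auto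
    then have "a \<noteq> Suc n" using l(2) \<open>l' < l\<close> m_pos by auto
    then show "\<exists>a. (f(Suc n := 0)) a = Suc l' * m \<and> (\<forall>i. l' * m < (f(Suc n := 0)) i \<longrightarrow> a \<le> i)"
      using a by (intro exI[of _ a]) auto
  qed (use rgf_outside[OF f] in auto)
  ultimately show ?thesis using that l(2) by blast
qed

lemma rgf_Suc:
  "{f. rgf m (Suc n) k f} =
     (\<lambda>(f, j). f(Suc n := j)) ` ({f. rgf m n k f} \<times> {..k * m}) \<union>
     (\<lambda>f. f(Suc n := k * m)) ` {f. 0 < k \<and> rgf m n (k - 1) f}" (is "_ = ?A \<union> ?B")
proof (intro equalityI subsetI)
  fix f assume "f \<in> {f. rgf m (Suc n) k f}"
  then have f: "rgf m (Suc n) k f" by simp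
  then show "f \<in> ?A \<union> ?B"
  proof (cases rule: rgf_Suc_cases)
    case 1
    have "f = (\<lambda>(f, j). f(Suc n := j)) (f(Suc n := 0), f (Suc n))" by simp
    then show ?thesis using 1 rgf_le[OF f] by blast
  next
    case (2 k')
    have "f = (\<lambda>f. f(Suc n := k * m)) (f(Suc n := 0))" using 2 by auto
    moreover have "f(Suc n := 0) \<in> {f. 0 < k \<and> rgf m n (k - 1) f}" using 2 by simp
    ultimately show ?thesis by blast
  qed
next
  fix f assume "f \<in> ?A \<union> ?B"
  then consider f' j where "rgf m n k f'" "j \<le> k * m" "f = f'(Suc n := j)"
    | f' where "0 < k" "rgf m n (k - 1) f'" "f = f'(Suc n := k * m)" by auto
  then show "f \<in> {f. rgf m (Suc n) k f}"
  proof cases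
    case 1
    then show ?thesis using rgf_upd by simp
  next
    case 2
    then show ?thesis using rgf_upd_new[OF 2(2)] by simp
  qed
qed

lemma rgf_0: "rgf m 0 k f \<longleftrightarrow> k = 0 \<and> f = (\<lambda>_. 0)"
proof
  assume f: "rgf m 0 k f"
  then have "f = (\<lambda>_. 0)" by (intro ext rgf_outside[OF f]) simp
  moreover have "k = 0"
  proof (rule ccontr)
    assume "k \<noteq> 0"
    then obtain a where "f a = Suc 0 * m" using rgf_opener[OF f, of 0] by blast
    then show False using calculation m_pos by simp
  qed
  ultimately show "k = 0 \<and> f = (\<lambda>_. 0)" by simp
qed (simp add: rgf_def)

lemma finite_rgf: "finite {f. rgf m n k f}"
proof (induction n arbitrary: k)
  case 0
  show ?case by (simp add: rgf_0)
next
  case (Suc n)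
  have "finite {f. 0 < k \<and> rgf m n (k - 1) f}"
    by (rule finite_subset[OF _ Suc.IH[of "k - 1"]]) auto
  then show ?case unfolding rgf_Suc using Suc.IH[of k] by auto
qed

text \<open>The opener of the last group attains the bound. This also recovers k from
  \<open>f\<close>, and so separates functions with different numbers of groups.\<close>

lemma Max_rgf:
  assumes f: "rgf m n k f"
  shows "Max (f ` {..n}) = k * m"
proof (rule Max_eqI)
  show "y \<le> k * m" if "y \<in> f ` {..n}" for y using that rgf_le[OF f] by auto
  show "k * m \<in> f ` {..n}"
  proof (cases k)
    case 0
    have "f 0 = 0" using rgf_outside[OF f] by simp
    then show ?thesis using 0 by (intro image_eqI[of _ _ 0]) simp_all
  next
    case (Suc l)
    then obtain a where a: "f a = k * m" using rgf_opener[OF f, of l] by blast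
    then have "a \<in> {1..n}" using rgf_outside[OF f, of a] m_pos Suc by fastforce
    then show ?thesis using a by (intro image_eqI[of _ _ a]) simp_all
  qed
qed simp

text \<open>The new point leaves earlier maxima unchanged, and its own running maximum is km. With j
  = km the formula also covers the opening of a group.\<close>

lemma rgf_weight_upd:
  assumes "rgf m (Suc n) k (f(Suc n := j))"
  shows "rgf_weight (Suc n) (f(Suc n := j)) = rgf_weight n f + (k * m - j)"
proof -
  have "(\<Sum>i = 1..n. Max (f(Suc n := j) ` {..i}) - (f(Suc n := j)) i) = rgf_weight n f"
    unfolding rgf_weight_def
  proof (rule sum.cong)
    fix i assume "i \<in> {1..n}"
    moreover from this have "f(Suc n := j) ` {..i} = f ` {..i}" by (intro image_cong) auto
    ultimately show "Max (f(Suc n := j) ` {..i}) - (f(Suc n := j)) i = Max (f ` {..i}) - f i"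
      by simp
  qed simp
  then show ?thesis
    using Max_rgf[OF assms] unfolding rgf_weight_def
    by (simp only: sum.cl_ivl_Suc fun_upd_same) simp
qed

section \<open>Recurrences\<close>

lemma sum_qvar_powers: "(\<Sum>j\<le>d. qvar ^ (d - j)) = qint (d + 1)"
  unfolding qint_def using sum.nat_diff_reindex[of "\<lambda>j. qvar ^ j" "d + 1"]
  by (simp add: lessThan_Suc_atMost)

lemma stirling_S_Suc:
  "stirling_S m (Suc n) k =
     (if k = 0 then 0 else stirling_S m n (k - 1)) + qint (k * m + 1) * stirling_S m n k"
proof -
  define A where "A = (\<lambda>(f, j). f(Suc n := j)) ` ({f. rgf m n k f} \<times> {..k * m})"
  define B where "B = (\<lambda>f. f(Suc n := k * m)) ` {f. 0 < k \<and> rgf m n (k - 1) f}"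
  \<comment> \<open>Resetting the value at n + 1 to 0 recovers the original function, which makes
    both extension maps injective.\<close>
  have undo: "f = f(Suc n := j, Suc n := 0)" if "rgf m n k f" for f j k
    using rgf_outside[OF that, of "Suc n"] by auto
  have fin: "finite A" "finite B"
    using finite_rgf[of "Suc n" k] unfolding rgf_Suc A_def B_def by simp_all
  have disj: "A \<inter> B = {}"
  proof (rule ccontr)
    assume "A \<inter> B \<noteq> {}"
    then obtain f j f' where f: "rgf m n k f" "0 < k" "rgf m n (k - 1) f'"
      "f(Suc n := j) = f'(Suc n := k * m)"
      unfolding A_def B_def by auto
    then have "f = f'" using undo by metis
    \<comment> \<open>The maximum over \<open>{..n}\<close> counts the groups, so a function cannot
      have both k and k - 1 of them.\<close>
    then have "k * m = (k - 1) * m" using Max_rgf f by metis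
    then show False using \<open>0 < k\<close> m_pos by simp
  qed
  have inj_A: "inj_on (\<lambda>(f, j). f(Suc n := j)) ({f. rgf m n k f} \<times> {..k * m})"
  proof (rule inj_onI, clarify)
    fix f j f' j' assume "rgf m n k f" "rgf m n k f'" and eq: "f(Suc n := j) = f'(Suc n := j')"
    then have "f = f'" using undo by metis
    moreover have "j = j'" using eq by (metis fun_upd_same)
    ultimately show "f = f' \<and> j = j'" by simp
  qed
  have inj_B: "inj_on (\<lambda>f. f(Suc n := k * m)) {f. 0 < k \<and> rgf m n (k - 1) f}"
    by (rule inj_onI) (use undo in \<open>metis mem_Collect_eq\<close>)
  have "(\<Sum>f\<in>A. qvar ^ rgf_weight (Suc n) f) =
      (\<Sum>(f, j)\<in>{f. rgf m n k f} \<times> {..k * m}. qvar ^ rgf_weight (Suc n) (f(Suc n := j)))"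
    unfolding A_def by (subst sum.reindex[OF inj_A]) (simp add: case_prod_unfold comp_def)
  also have "\<dots> = (\<Sum>(f, j)\<in>{f. rgf m n k f} \<times> {..k * m}. qvar ^ rgf_weight n f * qvar ^ (k * m - j))"
    by (intro sum.cong) (auto simp: rgf_weight_upd[OF rgf_upd] simp flip: power_add)
  also have "\<dots> = (\<Sum>f | rgf m n k f. qvar ^ rgf_weight n f) * (\<Sum>j\<le>k * m. qvar ^ (k * m - j))"
    by (simp add: sum_product sum.cartesian_product)
  also have "\<dots> = qint (k * m + 1) * stirling_S m n k"
    by (simp only: sum_qvar_powers stirling_S_eq_sum_rgf mult.commute)
  finally have A: "(\<Sum>f\<in>A. qvar ^ rgf_weight (Suc n) f) = qint (k * m + 1) * stirling_S m n k" .
  have "(\<Sum>f\<in>B. qvar ^ rgf_weight (Suc n) f) =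
      (\<Sum>f | 0 < k \<and> rgf m n (k - 1) f. qvar ^ rgf_weight (Suc n) (f(Suc n := k * m)))"
    unfolding B_def by (subst sum.reindex[OF inj_B]) simp
  also have "\<dots> = (\<Sum>f | 0 < k \<and> rgf m n (k - 1) f. qvar ^ rgf_weight n f)"
  proof (rule sum.cong)
    fix f assume "f \<in> {f. 0 < k \<and> rgf m n (k - 1) f}"
    then have f: "0 < k" "rgf m n (k - 1) f" by auto
    have "rgf m (Suc n) k (f(Suc n := k * m))" using rgf_upd_new[OF f(2)] f(1) by simp
    from rgf_weight_upd[OF this]
    show "qvar ^ rgf_weight (Suc n) (f(Suc n := k * m)) = qvar ^ rgf_weight n f" by simp
  qed simp
  also have "\<dots> = (if k = 0 then 0 else stirling_S m n (k - 1))"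
    by (simp add: stirling_S_eq_sum_rgf)
  finally have B: "(\<Sum>f\<in>B. qvar ^ rgf_weight (Suc n) f) = (if k = 0 then 0 else stirling_S m n (k - 1))" .
  have "stirling_S m (Suc n) k = (\<Sum>f\<in>A \<union> B. qvar ^ rgf_weight (Suc n) f)"
    unfolding stirling_S_eq_sum_rgf rgf_Suc A_def B_def ..
  also have "\<dots> = (\<Sum>f\<in>A. qvar ^ rgf_weight (Suc n) f) + (\<Sum>f\<in>B. qvar ^ rgf_weight (Suc n) f)"
    by (rule sum.union_disjoint[OF fin disj])
  finally show ?thesis by (simp only: A B add.commute)
qed

lemma stirling_S_0: "stirling_S m 0 k = (if k = 0 then 1 else 0)"
  by (simp add: stirling_S_eq_sum_rgf rgf_0 rgf_weight_def)

lemma stirling_S_above_diagonal: "n < k \<Longrightarrow> stirling_S m n k = 0"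
  by (induction n arbitrary: k) (simp_all add: stirling_S_0 stirling_S_Suc)

end

section \<open>Elementary symmetric polynomials and the numbers of the first kind\<close>

lemma elem_sym_neg: "j < 0 \<Longrightarrow> elem_sym I x j = 0"
  by (simp add: elem_sym_def)

lemma elem_sym_gt_card:
  assumes "finite I" "int (card I) < j"
  shows "elem_sym I x j = 0"
proof -
  have "int (card T) \<noteq> j" if "T \<subseteq> I" for T
    using assms(2) card_mono[OF assms(1) that] by simp
  then have "{T. T \<subseteq> I \<and> int (card T) = j} = {}" by blast
  then show ?thesis by (simp only: elem_sym_def sum.empty)
qed

text \<open>Subsets are split by whether they contain a. The integer degree allows j - 1 to be
  negative, so j = 0 is no special case.\<close>

lemma elem_sym_insert:
  assumes "finite I" "a \<notin> I"
  shows "elem_sym (insert a I) x j = elem_sym I x j + x a * elem_sym I x (j - 1)"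
proof -
  define A where "A = {T. T \<subseteq> I \<and> int (card T) = j}"
  define B where "B = {T. T \<subseteq> I \<and> int (card T) = j - 1}"
  have fin: "finite A" "finite B" using assms(1) by (auto simp: A_def B_def)
  have B: "a \<notin> T" "finite T" if "T \<in> B" for T
    using that assms by (auto simp: B_def intro: finite_subset)
  have "{T. T \<subseteq> insert a I \<and> int (card T) = j} = A \<union> insert a ` B"
  proof (intro equalityI subsetI)
    fix T assume T: "T \<in> {T. T \<subseteq> insert a I \<and> int (card T) = j}"
    show "T \<in> A \<union> insert a ` B"
    proof (cases "a \<in> T")
      case False
      then show ?thesis using T by (auto simp: A_def)
    next
      case True
      have "finite T" using T assms(1) by (auto intro: finite_subset[of T "insert a I"])
      then have "card T = Suc (card (T - {a}))" using True by (rule card.remove)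
      then have "T - {a} \<in> B" using T by (auto simp: B_def)
      then show ?thesis using True by (metis UnI2 image_eqI insert_Diff)
    qed
  next
    fix T assume "T \<in> A \<union> insert a ` B"
    then consider "T \<in> A" | T' where "T' \<in> B" "T = insert a T'" by blast
    then show "T \<in> {T. T \<subseteq> insert a I \<and> int (card T) = j}"
    proof cases
      case 1
      then show ?thesis by (auto simp: A_def)
    next
      case 2
      then have "card T = Suc (card T')" using B[OF 2(1)] by simp
      then show ?thesis using 2 by (auto simp: B_def)
    qed
  qed
  moreover have "A \<inter> insert a ` B = {}" using assms(2) by (auto simp: A_def)
  ultimately have "elem_sym (insert a I) x j = elem_sym I x j + (\<Sum>T\<in>insert a ` B. prod x T)"
    using fin by (simp add: elem_sym_def A_def sum.union_disjoint)
  also have "(\<Sum>T\<in>insert a ` B. prod x T) = (\<Sum>T\<in>B. prod x (insert a T))"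
  proof (subst sum.reindex)
    show "inj_on (insert a) B" by (rule inj_onI) (use B(1) insert_ident in metis)
  qed simp
  also have "\<dots> = (\<Sum>T\<in>B. x a * prod x T)"
    by (intro sum.cong refl prod.insert B)
  also have "\<dots> = x a * elem_sym I x (j - 1)"
    by (simp add: elem_sym_def B_def sum_distrib_left)
  finally show ?thesis .
qed

lemma stirling_s_above_diagonal: "n < k \<Longrightarrow> stirling_s m n k = 0"
  by (simp add: stirling_s_def elem_sym_neg)

lemma stirling_s_0: "stirling_s m 0 k = (if k = 0 then 1 else 0)"
proof -
  have "{T. T = {} \<and> card T = 0} = {{} :: nat set}" by auto
  then show ?thesis by (auto simp: stirling_s_above_diagonal stirling_s_def elem_sym_def)
qed

text \<open>Passing to n + 1 adds the variable [nm+1]; choosing it lowers the degree to n - k, whose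
  sign has the opposite parity, hence the minus. For k > n the exponents truncate and this parity
  argument fails, so that case is separate.\<close>

lemma stirling_s_Suc:
  "stirling_s m (Suc n) k =
     (if k = 0 then 0 else stirling_s m n (k - 1)) - qint (n * m + 1) * stirling_s m n k"
proof (cases "k \<le> n")
  case True
  then have "(- 1 :: int poly) ^ (Suc n - k) = - ((- 1) ^ (n - k))" by (simp add: Suc_diff_le)
  \<comment> \<open>For k = 0 the right-hand side has degree n + 1 in n variables and
    vanishes.\<close>
  moreover have "(if k = 0 then 0 else stirling_s m n (k - 1)) =
      (- 1) ^ (Suc n - k) * elem_sym {..<n} (\<lambda>i. qint (i * m + 1)) (int (Suc n) - int k)"
    by (cases k) (simp_all add: stirling_s_def elem_sym_gt_card)
  ultimately show ?thesis
    by (simp add: stirling_s_def lessThan_Suc elem_sym_insert algebra_simps)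
next
  case False
  then show ?thesis
    by (cases k) (simp_all add: stirling_s_def lessThan_Suc elem_sym_insert elem_sym_neg)
qed

section \<open>The inverse relation\<close>

lemma sum_stirling_s_stirling_S:
  assumes m: "0 < m"
  shows "(\<Sum>j\<le>n. stirling_s m n j * stirling_S m j k) = (if n = k then 1 else 0)"
proof (induction n arbitrary: k)
  case 0
  show ?case by (simp add: stirling_s_0 stirling_S_0 m)
next
  case (Suc n)
  have "(\<Sum>j\<le>Suc n. stirling_s m (Suc n) j * stirling_S m j k) =
      (\<Sum>j\<le>Suc n. (if j = 0 then 0 else stirling_s m n (j - 1)) * stirling_S m j k) -
      qint (n * m + 1) * (\<Sum>j\<le>Suc n. stirling_s m n j * stirling_S m j k)"
    by (simp only: stirling_s_Suc left_diff_distrib sum_subtractf sum_distrib_left mult.assoc)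
  \<comment> \<open>The index n + 1 contributes nothing since s[m,n,n+1] = 0, so the induction
    hypothesis applies.\<close>
  also have "(\<Sum>j\<le>Suc n. stirling_s m n j * stirling_S m j k) = (if n = k then 1 else 0)"
    by (simp add: stirling_s_above_diagonal Suc.IH)
  also have "(\<Sum>j\<le>Suc n. (if j = 0 then 0 else stirling_s m n (j - 1)) * stirling_S m j k) =
      (\<Sum>j\<le>n. stirling_s m n j * stirling_S m (Suc j) k)"
    by (simp add: sum.atMost_Suc_shift del: sum.atMost_Suc)
  also have "\<dots> = (\<Sum>j\<le>n. stirling_s m n j * (if k = 0 then 0 else stirling_S m j (k - 1))) +
      qint (k * m + 1) * (\<Sum>j\<le>n. stirling_s m n j * stirling_S m j k)"
    by (simp only: stirling_S_Suc[OF m] distrib_left sum.distrib sum_distrib_left mult.left_commute)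
  \<comment> \<open>The induction hypothesis enters at k - 1 here and at k elsewhere, hence the
    generalization over k.\<close>
  also have "(\<Sum>j\<le>n. stirling_s m n j * (if k = 0 then 0 else stirling_S m j (k - 1))) =
      (if Suc n = k then 1 else 0)"
    using Suc.IH[of "k - 1"] by (cases k) auto
  \<comment> \<open>The remaining terms are ([km+1] - [nm+1]) times the identity entry at (n,k): the
    factor vanishes for n = k, the entry otherwise.\<close>
  finally show ?case by (simp add: Suc.IH)
qed

theorem theorem6p2:
  fixes m :: nat
  assumes "m \<ge> 1"
  shows "lower_triangular (stirling_s m) \<and> lower_triangular (stirling_S m) \<and>
         inf_matrix_mult (stirling_s m) (stirling_S m) = inf_matrix_one"
proof (intro conjI)
  have m: "0 < m" using assms by simp
  show "lower_triangular (stirling_s m)"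
    by (simp add: lower_triangular_def stirling_s_above_diagonal)
  show "lower_triangular (stirling_S m)"
    by (simp add: lower_triangular_def stirling_S_above_diagonal m)
  have "Sum_any (\<lambda>j. stirling_s m n j * stirling_S m j k) = (if n = k then 1 else 0)" for n k
  proof -
    have "{j. stirling_s m n j * stirling_S m j k \<noteq> 0} \<subseteq> {..n}"
      using stirling_s_above_diagonal[of n _ m] by (auto simp: not_le[symmetric])
    from Sum_any.expand_superset[OF finite_atMost this] show ?thesis
      by (simp only: sum_stirling_s_stirling_S[OF m])
  qed
  then show "inf_matrix_mult (stirling_s m) (stirling_S m) = inf_matrix_one"
    by (simp add: inf_matrix_mult_def inf_matrix_one_def)
qed

end
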